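(* For integers $n > d \geq 0$, $$K(n,d+1) \;\geq\; \Omega_d\!\left(\frac{n!\,\log n}{n^{d}}\right).$$
   Context: Let $\mathbb{S}_n$ be the symmetric group of all permutations of $[n]=\{1,\dots,n\}$, with a permutation written as $\pi=(\pi_1,\dots,\pi_n)$. For distinct $i,j\in[n]$, the transposition $\varphi(i,j)$ sends $\pi$ to the permutation $\pi\varphi(i,j)$ obtained by swapping the entries $\pi_i$ and $\pi_j$ in positions $i$ and $j$; equivalently $\pi\varphi(i,j)=\pi\circ(i\ j)$, where $(\sigma\circ\tau)(k)=\sigma(\tau(k))$. It is called an adjacent transposition if $|i-j|=1$. The Kendall $\tau$-distance $d_K(\pi,\sigma)$ between $\pi,\sigma\in\mathbb{S}_n$ is the minimum $m\geq 0$ such that $\sigma=\pi\varphi_1\varphi_2\cdots\varphi_m$ for some adjacent transpositions $\varphi_1,\dots,\varphi_m$. A $d$-Kendall permutation code of length $n$ is a subset $\mathcal{K}\subseteq\mathbb{S}_n$ such that any two distinct elements of $\mathcal{K}$ have Kendall $\tau$-distance at least $d$. $K(n,d)$ denotes the maximum size of a $d$-Kendall permutation code of length $n$. The notation $f \geq \Omega_d(g)$ means that $f \geq c_d\, g$ for some constant $c_d>0$ depending only on $d$.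
   Formalization: The case d = 0 is excluded (d ≥ 1 is assumed): there K(n,1) = n!, so K(n,1) ≥ c·n!·log n fails for every fixed c > 0 once n > e^(1/c). *)

theory Defs
  imports Complex_Main "HOL-Combinatorics.Permutations"
begin

definition Sym :: "nat \<Rightarrow> (nat \<Rightarrow> nat) set" where
  "Sym n = {\<pi>. \<pi> permutes {1..n}}"

definition adjacent_transpositions :: "nat \<Rightarrow> (nat \<Rightarrow> nat) set" where
  "adjacent_transpositions n =
     {transpose i j | i j. i \<in> {1..n} \<and> j \<in> {1..n} \<and> \<bar>int i - int j\<bar> = 1}"

text \<open>
  The fold is \<open>\<pi> \<circ> \<phi>\<^sub>1 \<circ> \<dots> \<circ> \<phi>\<^sub>m\<close>: acting on the right swaps the
  entries at two neighbouring positions. Adjacent transpositions generate \<open>Sym n\<close>, so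
  the minimum is attained whenever \<open>\<pi>\<close> and \<open>\<sigma>\<close> lie in \<open>Sym n\<close>; for other
  arguments the value is irrelevant.
\<close>

definition kendall_dist :: "nat \<Rightarrow> (nat \<Rightarrow> nat) \<Rightarrow> (nat \<Rightarrow> nat) \<Rightarrow> nat" where
  "kendall_dist n \<pi> \<sigma> =
     (LEAST m. \<exists>\<phi>s. length \<phi>s = m \<and> set \<phi>s \<subseteq> adjacent_transpositions n
                  \<and> \<sigma> = foldl (\<circ>) \<pi> \<phi>s)"

definition kendall_code :: "nat \<Rightarrow> nat \<Rightarrow> (nat \<Rightarrow> nat) set \<Rightarrow> bool" where
  "kendall_code n d C \<longleftrightarrow>
     C \<subseteq> Sym n \<and> (\<forall>\<pi>\<in>C. \<forall>\<sigma>\<in>C. \<pi> \<noteq> \<sigma> \<longrightarrow> d \<le> kendall_dist n \<pi> \<sigma>)"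

text \<open>
  The maximum ranges over a finite set (codes are subsets of the finite set \<open>Sym n\<close>)
  which is nonempty (the empty set is a code).
\<close>

definition max_kendall_code :: "nat \<Rightarrow> nat \<Rightarrow> nat" where
  "max_kendall_code n d = Max {card C | C. kendall_code n d C}"

end

theory Submission
  imports Defs
begin

text \<open>
  A code of size of order \<open>n! / n ^ (d - 1)\<close> exists, and this is more than what is claimed
  because \<open>ln n \<le> n\<close>. It is the permutation analogue of a Varshamov--Tenengolts code.

  Encode a permutation by its inversion table, which records for each value \<open>b\<close> how many
  smaller values stand to the right of \<open>b\<close>. The table determines the permutation
  (\<open>inversion_table_inject\<close>). Swapping two neighbouring entries changes a single entry of the
  table, by one (\<open>inversion_table_adjacent_step\<close>), so Kendall distance is at least the \<open>\<ell>\<^sub>1\<close>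
  distance of the tables (\<open>l1_dist_le_kendall_dist\<close>).

  Let weights \<open>h\<^sub>1, \<dots>, h\<^sub>n\<close> modulo \<open>M\<close> be such that no nonzero integer vector \<open>e\<close> with
  \<open>\<ell>\<^sub>1\<close> norm at most \<open>d\<close> satisfies \<open>\<Sum> h\<^sub>i e\<^sub>i \<equiv> 0\<close>. Then permutations whose tables have the
  same weighted sum modulo \<open>M\<close> are at distance more than \<open>d\<close>, and some residue class contains
  at least \<open>n! / M\<close> permutations. Such weights can be chosen one after the other
  (\<open>separating_weights_exist\<close>): a new weight \<open>t\<close> is forbidden only if \<open>k t + s \<equiv> 0\<close> for a
  coefficient \<open>0 < \<bar>k\<bar> \<le> d\<close> and a combination \<open>s\<close> of the earlier weights of norm at most
  \<open>d - 1\<close>. As one unit of the norm is spent on \<open>k\<close>, there are only \<open>O(n ^ (d - 1))\<close> forbidden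
  values, so a modulus \<open>M\<close> of that order suffices. It is taken to be \<open>1\<close> modulo \<open>d!\<close>, which makes
  every \<open>k\<close> invertible.
\<close>

section \<open>Adjacent transpositions generate the symmetric group\<close>

lemma foldl_comp: "foldl (\<circ>) \<pi> \<phi>s = \<pi> \<circ> foldl (\<circ>) id \<phi>s"
proof (induction \<phi>s rule: rev_induct)
  case (snoc \<phi> \<phi>s)
  then show ?case by (simp add: o_assoc)
qed simp

definition adjacent_products :: "nat \<Rightarrow> (nat \<Rightarrow> nat) set" where
  "adjacent_products n = {foldl (\<circ>) id \<phi>s | \<phi>s. set \<phi>s \<subseteq> adjacent_transpositions n}"

lemma id_in_adjacent_products: "id \<in> adjacent_products n"
proof -
  have "id = foldl (\<circ>) id ([] :: (nat \<Rightarrow> nat) list)" by simp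
  moreover have "set ([] :: (nat \<Rightarrow> nat) list) \<subseteq> adjacent_transpositions n" by simp
  ultimately show ?thesis unfolding adjacent_products_def by blast
qed

lemma comp_in_adjacent_products:
  assumes "p \<in> adjacent_products n" "q \<in> adjacent_products n"
  shows "p \<circ> q \<in> adjacent_products n"
proof -
  obtain ps qs where ps: "p = foldl (\<circ>) id ps" "set ps \<subseteq> adjacent_transpositions n"
    and qs: "q = foldl (\<circ>) id qs" "set qs \<subseteq> adjacent_transpositions n"
    using assms unfolding adjacent_products_def by blast
  have "p \<circ> q = foldl (\<circ>) id (ps @ qs)"
    using ps(1) qs(1) by (simp add: foldl_comp[of "foldl (\<circ>) id ps"])
  then show ?thesis
    unfolding adjacent_products_def using ps(2) qs(2) by (auto intro!: exI[of _ "ps @ qs"])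
qed

lemma adjacent_in_adjacent_products:
  assumes "\<phi> \<in> adjacent_transpositions n"
  shows "\<phi> \<in> adjacent_products n"
proof -
  have "\<phi> = foldl (\<circ>) id [\<phi>]" by simp
  with assms show ?thesis unfolding adjacent_products_def by fastforce
qed

text \<open>
  Conjugating \<open>transpose i j\<close> by the swap of \<open>j\<close> and \<open>j + 1\<close> gives \<open>transpose i (j + 1)\<close>,
  so the distance of the two points can be increased one by one.
\<close>
lemma transpose_in_adjacent_products_less:
  assumes "1 \<le> i" "i < j" "j \<le> n"
  shows "transpose i j \<in> adjacent_products n"
proof -
  have "Suc i \<le> j" using assms(2) by simp
  then show ?thesis using assms(3)
  proof (induction j rule: dec_induct)
    case base
    then have "transpose i (Suc i) \<in> adjacent_transpositions n"
      using assms(1) unfolding adjacent_transpositions_def by force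
    then show ?case by (rule adjacent_in_adjacent_products)
  next
    case (step k)
    have "transpose k (Suc k) \<in> adjacent_transpositions n"
      using step.prems step.hyps assms(1) unfolding adjacent_transpositions_def by force
    then have adj: "transpose k (Suc k) \<in> adjacent_products n"
      by (rule adjacent_in_adjacent_products)
    have "transpose i (Suc k) = transpose k (Suc k) \<circ> transpose i k \<circ> transpose k (Suc k)"
      using step.hyps by (auto simp: fun_eq_iff transpose_def)
    moreover have "transpose i k \<in> adjacent_products n" using step by simp
    ultimately show ?case
      using adj by (simp only: comp_in_adjacent_products)
  qed
qed

lemma transpose_in_adjacent_products:
  assumes "i \<in> {1..n}" "j \<in> {1..n}"
  shows "transpose i j \<in> adjacent_products n"
proof (cases i j rule: linorder_cases)
  case equal
  then show ?thesis using id_in_adjacent_products by simp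
next
  case less
  then show ?thesis using assms by (simp add: transpose_in_adjacent_products_less)
next
  case greater
  then have "transpose j i \<in> adjacent_products n"
    using assms by (simp add: transpose_in_adjacent_products_less)
  then show ?thesis by (simp add: transpose_commute)
qed

lemma Sym_subset_adjacent_products: "Sym n \<subseteq> adjacent_products n"
proof
  fix p assume "p \<in> Sym n"
  then have "p permutes {1..n}" "finite {1..n}" by (simp_all add: Sym_def)
  then show "p \<in> adjacent_products n"
  proof (induction p rule: permutes_induct)
    case id
    show ?case by (rule id_in_adjacent_products)
  next
    case (swap a b p)
    then show ?case
      by (intro comp_in_adjacent_products transpose_in_adjacent_products) auto
  qed
qed

text \<open>
  A \<open>LEAST\<close> over an empty predicate is unspecified; generation guarantees that the minimum
  defining the Kendall distance is attained.
\<close>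
lemma kendall_dist_attained:
  assumes "\<pi> \<in> Sym n" "\<sigma> \<in> Sym n"
  obtains \<phi>s where "length \<phi>s = kendall_dist n \<pi> \<sigma>"
    "set \<phi>s \<subseteq> adjacent_transpositions n" "\<sigma> = foldl (\<circ>) \<pi> \<phi>s"
proof -
  have perm: "\<pi> permutes {1..n}" "\<sigma> permutes {1..n}" using assms by (auto simp: Sym_def)
  have "inv \<pi> \<circ> \<sigma> \<in> Sym n"
    using permutes_compose[OF perm(2) permutes_inv[OF perm(1)]] by (simp add: Sym_def)
  then have "inv \<pi> \<circ> \<sigma> \<in> adjacent_products n" using Sym_subset_adjacent_products by blast
  then obtain \<phi>s where \<phi>s: "set \<phi>s \<subseteq> adjacent_transpositions n"
    "inv \<pi> \<circ> \<sigma> = foldl (\<circ>) id \<phi>s"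
    unfolding adjacent_products_def by blast
  have "\<sigma> = \<pi> \<circ> (inv \<pi> \<circ> \<sigma>)" using perm(1) by (simp add: o_assoc permutes_inv_o)
  also have "\<dots> = foldl (\<circ>) \<pi> \<phi>s" by (simp only: \<phi>s(2) foldl_comp[of \<pi>])
  finally have "\<exists>m \<phi>s. length \<phi>s = m \<and> set \<phi>s \<subseteq> adjacent_transpositions n
      \<and> \<sigma> = foldl (\<circ>) \<pi> \<phi>s"
    using \<phi>s(1) by blast
  then have "\<exists>\<phi>s. length \<phi>s = kendall_dist n \<pi> \<sigma> \<and> set \<phi>s \<subseteq> adjacent_transpositions n
      \<and> \<sigma> = foldl (\<circ>) \<pi> \<phi>s"
    unfolding kendall_dist_def by (rule LeastI_ex)
  then show ?thesis using that by blast
qed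

section \<open>Inversion tables\<close>

text \<open>
  The argument is meant to be the inverse of a permutation \<open>\<pi>\<close>, so that \<open>q b\<close> is the position
  of the value \<open>b\<close>. Counting inversions by their larger value, not by position, is what lets a
  swap of two neighbouring entries touch one entry of the table only.
\<close>
definition inversion_table :: "(nat \<Rightarrow> nat) \<Rightarrow> nat \<Rightarrow> nat" where
  "inversion_table q b = card {a \<in> {1..<b}. q b < q a}"

text \<open>
  The table determines the relative order of the positions of \<open>1, \<dots>, b\<close> by induction on \<open>b\<close>:
  the values standing to the right of \<open>b\<close> form an upper set of the order on \<open>1, \<dots>, b - 1\<close>, and
  an upper set of a linear order is determined by its size.
\<close>
lemma inversion_table_determines_order:
  assumes inj: "inj_on p {1..n}" "inj_on q {1..n}"
    and table: "\<And>b. b \<in> {1..n} \<Longrightarrow> inversion_table p b = inversion_table q b"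
    and "b \<le> n" "a \<in> {1..b}" "a' \<in> {1..b}"
  shows "p a < p a' \<longleftrightarrow> q a < q a'"
  using assms(4-6)
proof (induction b arbitrary: a a')
  case (Suc b)
  let ?B = "Suc b"
  define U where "U r = {a \<in> {1..<?B}. r ?B < r a}" for r :: "nat \<Rightarrow> nat"
  have U_iff: "a \<in> U r \<longleftrightarrow> a \<in> {1..b} \<and> r ?B < r a" for a r
    by (auto simp: U_def)
  have fin: "finite (U p)" "finite (U q)" by (simp_all add: U_def)
  have card_eq: "card (U p) = card (U q)"
    using table[of ?B] Suc.prems(1) by (simp add: U_def inversion_table_def)
  have IH: "p a < p a' \<longleftrightarrow> q a < q a'" if "a \<in> {1..b}" "a' \<in> {1..b}" for a a'
    using Suc.IH[of a a'] that Suc.prems(1) by simp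
  have "U p \<subseteq> U q \<or> U q \<subseteq> U p"
  proof (rule ccontr)
    assume "\<not> ?thesis"
    then obtain u v where u: "u \<in> U p" "u \<notin> U q" and v: "v \<in> U q" "v \<notin> U p" by blast
    have "p v < p u" "\<not> q v < q u" using u v by (auto simp: U_iff)
    moreover have "u \<in> {1..b}" "v \<in> {1..b}" using u v by (auto simp: U_iff)
    ultimately show False using IH by blast
  qed
  then have U_eq: "U p = U q" using card_eq fin card_subset_eq by metis
  have right: "p ?B < p a \<longleftrightarrow> q ?B < q a" if "a \<in> {1..b}" for a
    using U_eq U_iff that by blast
  have ne: "p ?B \<noteq> p a" "q ?B \<noteq> q a" if "a \<in> {1..b}" for a
    using inj that Suc.prems(1) by (auto dest!: inj_onD)
  have left: "p a < p ?B \<longleftrightarrow> q a < q ?B" if "a \<in> {1..b}" for a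
    using right[OF that] ne[OF that] by linarith
  show ?case
  proof (cases "a = ?B"; cases "a' = ?B")
    assume "a \<noteq> ?B" "a' \<noteq> ?B"
    then show ?thesis using IH[of a a'] Suc.prems by simp
  next
    assume "a \<noteq> ?B" "a' = ?B"
    then show ?thesis using left[of a] Suc.prems by simp
  next
    assume "a = ?B" "a' \<noteq> ?B"
    then show ?thesis using right[of a'] Suc.prems by simp
  qed simp
qed simp

lemma permutes_eq_card_le:
  assumes "p permutes {1..n}" "a \<in> {1..n}"
  shows "p a = card {b \<in> {1..n}. p b \<le> p a}"
proof -
  have pa: "p a \<in> {1..n}" using permutes_in_image[OF assms(1)] assms(2) by blast
  have "p ` {b \<in> {1..n}. p b \<le> p a} = {1..p a}"
  proof
    show "p ` {b \<in> {1..n}. p b \<le> p a} \<subseteq> {1..p a}"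
      using permutes_in_image[OF assms(1)] by force
    show "{1..p a} \<subseteq> p ` {b \<in> {1..n}. p b \<le> p a}"
    proof
      fix y assume y: "y \<in> {1..p a}"
      then have "y \<in> p ` {1..n}" using pa permutes_image[OF assms(1)] by simp
      then show "y \<in> p ` {b \<in> {1..n}. p b \<le> p a}" using y by auto
    qed
  qed
  moreover have "inj_on p {b \<in> {1..n}. p b \<le> p a}"
    using permutes_inj_on[OF assms(1)] by blast
  ultimately show ?thesis by (metis card_image card_atLeastAtMost diff_Suc_1)
qed

lemma inversion_table_inject:
  assumes p: "p permutes {1..n}" and q: "q permutes {1..n}"
    and table: "\<And>b. b \<in> {1..n} \<Longrightarrow> inversion_table p b = inversion_table q b"
  shows "p = q"
proof
  fix a
  show "p a = q a"
  proof (cases "a \<in> {1..n}")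
    case True
    have "p b \<le> p a \<longleftrightarrow> q b \<le> q a" if "b \<in> {1..n}" for b
      using inversion_table_determines_order[OF permutes_inj_on[OF p] permutes_inj_on[OF q]
          table order.refl True that] by (simp add: linorder_not_less[symmetric])
    then have "{b \<in> {1..n}. p b \<le> p a} = {b \<in> {1..n}. q b \<le> q a}" by blast
    then show ?thesis
      using permutes_eq_card_le[OF p True] permutes_eq_card_le[OF q True] by simp
  next
    case False
    then show ?thesis using p q by (simp add: permutes_not_in)
  qed
qed

definition table_dist :: "nat \<Rightarrow> (nat \<Rightarrow> nat) \<Rightarrow> (nat \<Rightarrow> nat) \<Rightarrow> int" where
  "table_dist n p q =
     (\<Sum>b\<in>{1..n}. \<bar>int (inversion_table p b) - int (inversion_table q b)\<bar>)"

lemma table_dist_triangle: "table_dist n p r \<le> table_dist n p q + table_dist n q r"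
  unfolding table_dist_def sum.distrib[symmetric] by (rule sum_mono) linarith

lemma card_diff_le_1:
  assumes "finite A" "finite B" "A - {x} = B - {x}"
  shows "\<bar>int (card A) - int (card B)\<bar> \<le> 1"
proof -
  have "card (A - {x}) = card (B - {x})" using assms(3) by simp
  then show ?thesis
    using card_Diff1_le[of A x] card_Diff1_le[of B x] diff_card_le_card_Diff[of "{x}" A]
      diff_card_le_card_Diff[of "{x}" B] by simp
qed

text \<open>
  Exchanging the positions \<open>i\<close> and \<open>i + 1\<close> alters no comparison of positions except the one
  between the two values standing there, and that comparison is counted at the larger value.
\<close>
lemma inversion_table_adjacent_step:
  assumes q: "q permutes {1..n}" and i: "i \<in> {1..n}" "Suc i \<in> {1..n}"
  shows "table_dist n q (transpose i (Suc i) \<circ> q) \<le> 1"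
proof -
  let ?r = "transpose i (Suc i) \<circ> q"
  obtain u v where u: "u \<in> {1..n}" "q u = i" and v: "v \<in> {1..n}" "q v = Suc i"
    using i permutes_image[OF q] by (metis imageE)
  have inj: "q x = q y \<longleftrightarrow> x = y" for x y using permutes_inj[OF q] by (simp add: inj_eq)
  have cmp: "?r b < ?r a \<longleftrightarrow> q b < q a" if "\<not> (a = u \<and> b = v)" "\<not> (a = v \<and> b = u)" for a b
    using that inj[of a u] inj[of a v] inj[of b u] inj[of b v] u(2) v(2)
    by (auto simp: transpose_def)
  define hi where "hi = max u v"
  define lo where "lo = min u v"
  have other: "inversion_table q b = inversion_table ?r b" if "b \<noteq> hi" for b
  proof -
    have "{a \<in> {1..<b}. q b < q a} = {a \<in> {1..<b}. ?r b < ?r a}"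
      by (rule Collect_cong, rule conj_cong[OF refl], rule cmp[symmetric])
        (use that in \<open>auto simp: hi_def\<close>)
    then show ?thesis by (simp only: inversion_table_def)
  qed
  have "\<bar>int (inversion_table q hi) - int (inversion_table ?r hi)\<bar> \<le> 1"
    unfolding inversion_table_def
  proof (rule card_diff_le_1[where x = lo])
    have "q hi < q a \<longleftrightarrow> ?r hi < ?r a" if "a \<noteq> lo" "a < hi" for a
      by (rule cmp[symmetric]) (use that in \<open>auto simp: lo_def hi_def\<close>)
    then show "{a \<in> {1..<hi}. q hi < q a} - {lo} = {a \<in> {1..<hi}. ?r hi < ?r a} - {lo}"
      by auto
  qed auto
  moreover have "hi \<in> {1..n}" using u v by (auto simp: hi_def max_def)
  then have "table_dist n q ?r = \<bar>int (inversion_table q hi) - int (inversion_table ?r hi)\<bar>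
      + (\<Sum>b\<in>{1..n} - {hi}. \<bar>int (inversion_table q b) - int (inversion_table ?r b)\<bar>)"
    unfolding table_dist_def by (subst sum.remove) auto
  moreover have "(\<Sum>b\<in>{1..n} - {hi}. \<bar>int (inversion_table q b) - int (inversion_table ?r b)\<bar>) = 0"
    by (rule sum.neutral) (use other in auto)
  ultimately show ?thesis by simp
qed

lemma adjacent_transpositionE:
  assumes "\<phi> \<in> adjacent_transpositions n"
  obtains i where "\<phi> = transpose i (Suc i)" "i \<in> {1..n}" "Suc i \<in> {1..n}"
proof -
  obtain i j where ij: "\<phi> = transpose i j" "i \<in> {1..n}" "j \<in> {1..n}" "\<bar>int i - int j\<bar> = 1"
    using assms unfolding adjacent_transpositions_def by blast
  then have "j = Suc i \<or> i = Suc j" by linarith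
  then show ?thesis using ij that[of i] that[of j] by (auto simp: transpose_commute)
qed

lemma foldl_adjacent_in_Sym:
  assumes "\<pi> \<in> Sym n" "set \<phi>s \<subseteq> adjacent_transpositions n"
  shows "foldl (\<circ>) \<pi> \<phi>s \<in> Sym n"
  using assms(2)
proof (induction \<phi>s rule: rev_induct)
  case (snoc \<phi> \<phi>s)
  then obtain i where "\<phi> = transpose i (Suc i)" "i \<in> {1..n}" "Suc i \<in> {1..n}"
    by (auto elim: adjacent_transpositionE)
  then have "\<phi> permutes {1..n}" by (simp add: permutes_swap_id)
  moreover have "set \<phi>s \<subseteq> adjacent_transpositions n" using snoc.prems by simp
  then have "foldl (\<circ>) \<pi> \<phi>s permutes {1..n}" using snoc.IH unfolding Sym_def by blast
  ultimately have "foldl (\<circ>) \<pi> \<phi>s \<circ> \<phi> permutes {1..n}" by (rule permutes_compose)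
  then show ?case by (simp only: Sym_def mem_Collect_eq foldl_append foldl.simps)
qed (use assms(1) in simp)

lemma table_dist_foldl_le_length:
  assumes "\<pi> \<in> Sym n" "set \<phi>s \<subseteq> adjacent_transpositions n"
  shows "table_dist n (inv \<pi>) (inv (foldl (\<circ>) \<pi> \<phi>s)) \<le> int (length \<phi>s)"
  using assms(2)
proof (induction \<phi>s rule: rev_induct)
  case Nil
  then show ?case by (simp add: table_dist_def)
next
  case (snoc \<phi> \<phi>s)
  then obtain i where i: "\<phi> = transpose i (Suc i)" "i \<in> {1..n}" "Suc i \<in> {1..n}"
    by (auto elim: adjacent_transpositionE)
  define \<rho> where "\<rho> = foldl (\<circ>) \<pi> \<phi>s"
  have \<rho>: "\<rho> permutes {1..n}"
    using foldl_adjacent_in_Sym[OF assms(1)] snoc.prems by (simp add: \<rho>_def Sym_def)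
  have "inv (\<rho> \<circ> \<phi>) = \<phi> \<circ> inv \<rho>"
    using o_inv_distrib[OF permutes_bij[OF \<rho>] permutes_bij[OF permutes_swap_id[OF i(2,3)]]] i(1)
    by simp
  then have "table_dist n (inv \<rho>) (inv (\<rho> \<circ> \<phi>)) \<le> 1"
    using inversion_table_adjacent_step[OF permutes_inv[OF \<rho>] i(2,3)] i(1) by simp
  moreover have "set \<phi>s \<subseteq> adjacent_transpositions n" using snoc.prems by simp
  then have "table_dist n (inv \<pi>) (inv \<rho>) \<le> int (length \<phi>s)"
    using snoc.IH unfolding \<rho>_def by blast
  ultimately have "table_dist n (inv \<pi>) (inv (\<rho> \<circ> \<phi>)) \<le> int (length \<phi>s) + 1"
    using table_dist_triangle[of n "inv \<pi>" "inv (\<rho> \<circ> \<phi>)" "inv \<rho>"] by linarith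
  moreover have "foldl (\<circ>) \<pi> (\<phi>s @ [\<phi>]) = \<rho> \<circ> \<phi>" by (simp only: \<rho>_def foldl_append foldl.simps)
  ultimately show ?case by (simp only: length_append_singleton of_nat_Suc add.commute)
qed

lemma l1_dist_le_kendall_dist:
  assumes "\<pi> \<in> Sym n" "\<sigma> \<in> Sym n"
  shows "table_dist n (inv \<pi>) (inv \<sigma>) \<le> int (kendall_dist n \<pi> \<sigma>)"
proof -
  obtain \<phi>s where "length \<phi>s = kendall_dist n \<pi> \<sigma>"
    "set \<phi>s \<subseteq> adjacent_transpositions n" "\<sigma> = foldl (\<circ>) \<pi> \<phi>s"
    using kendall_dist_attained[OF assms] .
  then show ?thesis using table_dist_foldl_le_length[OF assms(1)] by metis
qed

section \<open>Weights separating short integer vectors\<close>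

definition l1_ball :: "nat \<Rightarrow> nat \<Rightarrow> (nat \<Rightarrow> int) set" where
  "l1_ball m k = {e. (\<forall>i. i \<notin> {1..m} \<longrightarrow> e i = 0) \<and> (\<Sum>i\<in>{1..m}. \<bar>e i\<bar>) \<le> int k}"

text \<open>
  A vector of norm \<open>k + 1\<close> arises from one of norm \<open>k\<close> by changing one coordinate by one. The
  coordinate \<open>0\<close>, which lies outside the support, and the change \<open>0\<close> take care of the vectors
  of norm at most \<open>k\<close>, including the zero vector when \<open>m = 0\<close>.
\<close>
lemma l1_ball_Suc_subset:
  "l1_ball m (Suc k) \<subseteq> (\<lambda>(e, i, s). e(i := e i + s)) ` (l1_ball m k \<times> {0..m} \<times> {-1, 0, 1})"
proof
  fix e assume e: "e \<in> l1_ball m (Suc k)"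
  show "e \<in> (\<lambda>(e, i, s). e(i := e i + s)) ` (l1_ball m k \<times> {0..m} \<times> {-1, 0, 1})"
  proof (cases "\<exists>i\<in>{1..m}. e i \<noteq> 0")
    case False
    then have "e \<in> l1_ball m k" using e by (simp add: l1_ball_def)
    then show ?thesis by (intro image_eqI[of _ _ "(e, 0, 0)"]) auto
  next
    case True
    then obtain i where i: "i \<in> {1..m}" "e i \<noteq> 0" by blast
    let ?e' = "e(i := e i - sgn (e i))"
    have "(\<Sum>j\<in>{1..m}. \<bar>?e' j\<bar>) = \<bar>?e' i\<bar> + (\<Sum>j\<in>{1..m} - {i}. \<bar>?e' j\<bar>)"
      using i(1) by (intro sum.remove) auto
    also have "(\<Sum>j\<in>{1..m} - {i}. \<bar>?e' j\<bar>) = (\<Sum>j\<in>{1..m} - {i}. \<bar>e j\<bar>)"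
      by (rule sum.cong) auto
    also have "\<bar>?e' i\<bar> = \<bar>e i\<bar> - 1" using i(2) by (auto simp: sgn_if)
    also have "\<bar>e i\<bar> - 1 + (\<Sum>j\<in>{1..m} - {i}. \<bar>e j\<bar>) = (\<Sum>j\<in>{1..m}. \<bar>e j\<bar>) - 1"
      using i(1) by (subst sum.remove[of "{1..m}" i]) auto
    finally have "?e' \<in> l1_ball m k" using e i(1) by (auto simp: l1_ball_def)
    moreover have "sgn (e i) \<in> {-1, 0, 1}" by (auto simp: sgn_if)
    ultimately show ?thesis
      using i(1) by (intro image_eqI[of _ _ "(?e', i, sgn (e i))"]) auto
  qed
qed

lemma card_l1_ball_le: "finite (l1_ball m k) \<and> card (l1_ball m k) \<le> (3 * Suc m) ^ k"
proof (induction k)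
  case 0
  have "e = (\<lambda>_. 0)" if "e \<in> l1_ball m 0" for e
  proof
    fix i
    have "(\<Sum>j\<in>{1..m}. \<bar>e j\<bar>) = 0"
      using that by (intro antisym) (auto simp: l1_ball_def sum_nonneg)
    then have "\<forall>j\<in>{1..m}. \<bar>e j\<bar> = 0" by (subst (asm) sum_nonneg_eq_0_iff) auto
    then show "e i = 0" using that by (cases "i \<in> {1..m}") (auto simp: l1_ball_def)
  qed
  then have "l1_ball m 0 \<subseteq> {\<lambda>_. 0}" by blast
  then show ?case using finite_subset card_mono[of "{\<lambda>_. 0}" "l1_ball m 0"] by auto
next
  case (Suc k)
  let ?D = "l1_ball m k \<times> {0..m} \<times> {-1, 0, 1 :: int}"
  have fin: "finite ?D" using Suc by simp
  have "card (l1_ball m (Suc k)) \<le> card ?D"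
    by (rule surj_card_le[OF fin l1_ball_Suc_subset])
  also have "\<dots> = card (l1_ball m k) * (3 * Suc m)" by (simp add: card_cartesian_product algebra_simps)
  also have "\<dots> \<le> (3 * Suc m) ^ k * (3 * Suc m)" using Suc by (intro mult_right_mono) auto
  finally show ?case
    using finite_subset[OF l1_ball_Suc_subset finite_imageI[OF fin]] by (simp add: mult.commute)
qed

lemma card_solutions_le_1:
  fixes M k s :: int
  assumes "coprime k M"
  shows "card {t \<in> {0..<M}. M dvd k * t + s} \<le> 1"
proof (rule card_le_Suc0_iff_eq[THEN iffD2, unfolded One_nat_def[symmetric]])
  have "t = t'" if t: "t \<in> {0..<M}" "M dvd k * t + s" and t': "t' \<in> {0..<M}" "M dvd k * t' + s"
    for t t'
  proof -
    have "M dvd k * (t - t')" using dvd_diff[OF t(2) t'(2)] by (simp add: algebra_simps)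
    then have "M dvd t - t'" using assms by (simp add: coprime_commute coprime_dvd_mult_right_iff)
    then have "t mod M = t' mod M" by (simp add: mod_eq_dvd_iff)
    then show ?thesis using t(1) t'(1) by simp
  qed
  then show "\<forall>t\<in>{t \<in> {0..<M}. M dvd k * t + s}. \<forall>t'\<in>{t \<in> {0..<M}. M dvd k * t + s}. t = t'"
    by blast
  show "finite {t \<in> {0..<M}. M dvd k * t + s}"
    by (rule finite_subset[of _ "{0..<M}"]) auto
qed

definition separating_weights :: "int \<Rightarrow> nat \<Rightarrow> nat \<Rightarrow> (nat \<Rightarrow> int) \<Rightarrow> bool" where
  "separating_weights M d m h \<longleftrightarrow>
     (\<forall>e. (\<Sum>i\<in>{1..m}. \<bar>e i\<bar>) \<le> int d \<longrightarrow> M dvd (\<Sum>i\<in>{1..m}. h i * e i)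
        \<longrightarrow> (\<forall>i\<in>{1..m}. e i = 0))"

text \<open>
  One greedy step. A forbidden value of the new weight solves \<open>k t + s \<equiv> 0\<close> with
  \<open>0 < \<bar>k\<bar> \<le> d\<close> and \<open>s\<close> coming from a vector in the ball of radius \<open>d - 1\<close>; each of
  these congruences has at most one solution, so counting leaves a permitted value.
\<close>
lemma separating_weights_extend:
  assumes h: "separating_weights M d m h"
    and cop: "\<And>k. k \<in> {- int d..int d} - {0} \<Longrightarrow> coprime k M"
    and M: "int (2 * d * (3 * Suc m) ^ (d - 1)) < M"
  shows "\<exists>h. separating_weights M d (Suc m) h"
proof -
  define S where "S e = (\<Sum>i\<in>{1..m}. h i * e i)" for e :: "nat \<Rightarrow> int"
  let ?P = "({- int d..int d} - {0}) \<times> l1_ball m (d - 1)"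
  define bad where "bad = (\<Union>(k, e)\<in>?P. {t \<in> {0..<M}. M dvd k * t + S e})"
  have fin: "finite ?P" using card_l1_ball_le by auto
  have "card bad \<le> (\<Sum>(k, e)\<in>?P. card {t \<in> {0..<M}. M dvd k * t + S e})"
    unfolding bad_def case_prod_unfold by (rule card_UN_le[OF fin])
  also have "\<dots> \<le> (\<Sum>(k, e)\<in>?P. 1)"
    by (rule sum_mono) (auto simp only: mem_Times_iff split_beta intro!: card_solutions_le_1 cop)
  also have "\<dots> = 2 * d * card (l1_ball m (d - 1))"
    by (simp add: case_prod_unfold card_cartesian_product card_Diff_singleton nat_add_distrib
        nat_mult_distrib)
  also have "\<dots> \<le> 2 * d * (3 * Suc m) ^ (d - 1)"
    using card_l1_ball_le by (intro mult_left_mono) auto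
  finally have "int (card bad) < M" using M by linarith
  then have "card bad < card {0..<M}" by simp
  moreover have "finite bad"
    by (rule finite_subset[of _ "{0..<M}"]) (auto simp: bad_def)
  ultimately have "\<not> {0..<M} \<subseteq> bad" using card_mono by (metis linorder_not_less)
  then obtain t where t: "t \<in> {0..<M}" "t \<notin> bad" by blast
  have "separating_weights M d (Suc m) (h(Suc m := t))"
    unfolding separating_weights_def
  proof (intro allI impI)
    fix e :: "nat \<Rightarrow> int"
    assume norm: "(\<Sum>i\<in>{1..Suc m}. \<bar>e i\<bar>) \<le> int d"
      and dvd: "M dvd (\<Sum>i\<in>{1..Suc m}. (h(Suc m := t)) i * e i)"
    let ?k = "e (Suc m)"
    have norm': "(\<Sum>i\<in>{1..m}. \<bar>e i\<bar>) + \<bar>?k\<bar> \<le> int d" using norm by simp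
    have "(\<Sum>i\<in>{1..m}. (h(Suc m := t)) i * e i) = S e"
      unfolding S_def by (rule sum.cong) auto
    then have dvd': "M dvd ?k * t + S e" using dvd by (simp add: algebra_simps)
    have k0: "?k = 0"
    proof (rule ccontr)
      assume k: "?k \<noteq> 0"
      let ?e = "\<lambda>i. if i \<in> {1..m} then e i else 0"
      have "(\<Sum>i\<in>{1..m}. \<bar>?e i\<bar>) = (\<Sum>i\<in>{1..m}. \<bar>e i\<bar>)" by (rule sum.cong) auto
      also have "\<dots> \<le> int (d - 1)" using norm' k by linarith
      finally have ball: "?e \<in> l1_ball m (d - 1)" by (auto simp: l1_ball_def)
      have "S ?e = S e" unfolding S_def by (rule sum.cong) auto
      then have sol: "t \<in> {t \<in> {0..<M}. M dvd ?k * t + S ?e}" using dvd' t(1) by simp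
      have "0 \<le> (\<Sum>i\<in>{1..m}. \<bar>e i\<bar>)" by (simp add: sum_nonneg)
      then have "\<bar>?k\<bar> \<le> int d" using norm' by linarith
      then have "?k \<in> {- int d..int d} - {0}" using k by auto
      then have "(?k, ?e) \<in> ?P" using ball by blast
      then have "t \<in> bad" unfolding bad_def using sol by blast
      then show False using t(2) by simp
    qed
    have "\<forall>i\<in>{1..m}. e i = 0"
      using h norm' dvd' k0 unfolding separating_weights_def S_def by simp
    then show "\<forall>i\<in>{1..Suc m}. e i = 0" using k0 by (auto simp: le_Suc_eq)
  qed
  then show ?thesis by blast
qed

lemma separating_weights_exist:
  assumes cop: "\<And>k. k \<in> {- int d..int d} - {0} \<Longrightarrow> coprime k M"
    and M: "int (2 * d * (3 * n) ^ (d - 1)) < M"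
  shows "\<exists>h. separating_weights M d n h"
proof -
  have "\<exists>h. separating_weights M d m h" if "m \<le> n" for m
    using that
  proof (induction m)
    case 0
    show ?case by (simp add: separating_weights_def)
  next
    case (Suc m)
    then obtain h where h: "separating_weights M d m h" by auto
    have "2 * d * (3 * Suc m) ^ (d - 1) \<le> 2 * d * (3 * n) ^ (d - 1)"
      using Suc.prems by (intro mult_left_mono power_mono) auto
    then have "int (2 * d * (3 * Suc m) ^ (d - 1)) < M" using M by linarith
    then show ?case using separating_weights_extend[OF h cop] by blast
  qed
  then show ?thesis by blast
qed

lemma coprime_fact_mult_plus_1:
  fixes k :: int and d N :: nat
  assumes "k \<in> {- int d..int d} - {0}"
  shows "coprime k (int (fact d * N + 1))"
proof -
  have "nat \<bar>k\<bar> dvd fact d" using assms by (intro dvd_fact) auto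
  then have "k dvd int (fact d * N)" by (simp add: int_dvd_int_iff[symmetric] del: of_nat_fact)
  then obtain j where "int (fact d * N) = k * j" by (auto elim: dvdE)
  then have "int (fact d * N + 1) = k * j + 1" by simp
  then show ?thesis by (metis add.commute coprime_iff_gcd_eq_1 gcd_1_int gcd_add_mult mult.commute)
qed

section \<open>The code\<close>

lemma kendall_code_of_weights:
  assumes h: "separating_weights M d n h"
  defines "f \<equiv> \<lambda>\<pi>. (\<Sum>b\<in>{1..n}. h b * int (inversion_table (inv \<pi>) b)) mod M"
  shows "kendall_code n (d + 1) {\<pi> \<in> Sym n. f \<pi> = r}"
proof -
  have "d < kendall_dist n \<pi> \<sigma>"
    if \<pi>: "\<pi> \<in> Sym n" and \<sigma>: "\<sigma> \<in> Sym n" and "f \<pi> = f \<sigma>" "\<pi> \<noteq> \<sigma>" for \<pi> \<sigma>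
  proof (rule ccontr)
    assume "\<not> d < kendall_dist n \<pi> \<sigma>"
    then have short: "table_dist n (inv \<pi>) (inv \<sigma>) \<le> int d"
      using l1_dist_le_kendall_dist[OF \<pi> \<sigma>] by linarith
    let ?e = "\<lambda>b. int (inversion_table (inv \<pi>) b) - int (inversion_table (inv \<sigma>) b)"
    have "M dvd (\<Sum>b\<in>{1..n}. h b * ?e b)"
      using \<open>f \<pi> = f \<sigma>\<close>
      by (simp add: f_def mod_eq_dvd_iff right_diff_distrib sum_subtractf)
    then have "\<forall>b\<in>{1..n}. ?e b = 0"
      using h[unfolded separating_weights_def, rule_format, of ?e]
        short[unfolded table_dist_def] by blast
    moreover have perm: "\<pi> permutes {1..n}" "\<sigma> permutes {1..n}"
      using \<pi> \<sigma> by (auto simp: Sym_def)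
    ultimately have "inv \<pi> = inv \<sigma>"
      by (intro inversion_table_inject[where n = n] permutes_inv) auto
    then have "\<pi> = \<sigma>" using perm by (metis permutes_inv_inv)
    then show False using \<open>\<pi> \<noteq> \<sigma>\<close> by simp
  qed
  then show ?thesis by (auto simp: kendall_code_def Suc_le_eq)
qed

lemma finite_Sym: "finite (Sym n)"
  unfolding Sym_def by (simp add: finite_permutations)

lemma card_le_max_kendall_code:
  assumes "kendall_code n d C"
  shows "card C \<le> max_kendall_code n d"
proof -
  have "{card C | C. kendall_code n d C} \<subseteq> card ` Pow (Sym n)"
    by (auto simp: kendall_code_def)
  then have "finite {card C | C. kendall_code n d C}"
    using finite_Sym by (meson finite_Pow_iff finite_imageI finite_subset)
  then show ?thesis using assms unfolding max_kendall_code_def by (intro Max_ge) auto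
qed

lemma fact_le_modulus_mult_max_kendall_code:
  assumes h: "separating_weights (int M) d n h" and "M > 0"
  shows "fact n \<le> M * max_kendall_code n (d + 1)"
proof -
  define f where "f \<pi> = (\<Sum>b\<in>{1..n}. h b * int (inversion_table (inv \<pi>) b)) mod int M" for \<pi>
  have "Sym n = (\<Union>r\<in>{0..<int M}. {\<pi> \<in> Sym n. f \<pi> = r})"
    using \<open>M > 0\<close> by (auto simp: f_def)
  then have "card (Sym n) \<le> (\<Sum>r\<in>{0..<int M}. card {\<pi> \<in> Sym n. f \<pi> = r})"
    using card_UN_le[of "{0..<int M}" "\<lambda>r. {\<pi> \<in> Sym n. f \<pi> = r}"] by simp
  also have "\<dots> \<le> (\<Sum>r\<in>{0..<int M}. max_kendall_code n (d + 1))"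
    unfolding f_def by (intro sum_mono card_le_max_kendall_code kendall_code_of_weights[OF h])
  finally have "card (Sym n) \<le> M * max_kendall_code n (d + 1)" by simp
  then show ?thesis unfolding Sym_def by (simp add: card_permutations)
qed

text \<open>
  The greedy choice has at most \<open>N = 2 d (3 n) ^ (d - 1)\<close> forbidden values to avoid at each step,
  and \<open>M = d! N + 1\<close> exceeds \<open>N\<close> while being coprime to all coefficients up to \<open>d\<close>. The
  constant is what remains of \<open>M\<close> after dividing by \<open>n ^ (d - 1)\<close>.
\<close>
lemma fact_le_max_kendall_code:
  assumes "n > 0"
  shows "fact n \<le> (fact d * (2 * d * 3 ^ (d - 1)) + 1) * n ^ (d - 1) * max_kendall_code n (d + 1)"
proof -
  define N where "N = 2 * d * (3 * n) ^ (d - 1)"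
  define M where "M = fact d * N + 1"
  have "1 * N \<le> fact d * N" by (intro mult_right_mono fact_ge_1) simp
  then have "N < M" unfolding M_def by linarith
  then have "int (2 * d * (3 * n) ^ (d - 1)) < int M" unfolding N_def by (simp only: of_nat_less_iff)
  moreover have "coprime k (int M)" if "k \<in> {- int d..int d} - {0}" for k
    unfolding M_def using that by (rule coprime_fact_mult_plus_1)
  ultimately obtain h where "separating_weights (int M) d n h"
    using separating_weights_exist by blast
  then have "fact n \<le> M * max_kendall_code n (d + 1)"
    by (rule fact_le_modulus_mult_max_kendall_code) (simp add: M_def)
  also have "M \<le> (fact d * (2 * d * 3 ^ (d - 1)) + 1) * n ^ (d - 1)"
    using \<open>n > 0\<close> by (simp add: M_def N_def power_mult_distrib algebra_simps)
  finally show ?thesis by simp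
qed

theorem theorem2:
  fixes d :: nat
  assumes "d \<ge> 1"
  shows "\<exists>c::real. c > 0 \<and>
    (\<forall>n::nat. n > d \<longrightarrow>
      real (max_kendall_code n (d + 1)) \<ge> c * (fact n * ln (real n) / real n ^ d))"
proof -
  define A :: nat where "A = fact d * (2 * d * 3 ^ (d - 1)) + 1"
  have A: "real A > 0" unfolding A_def of_nat_0_less_iff by simp
  have "real (max_kendall_code n (d + 1)) \<ge> 1 / real A * (fact n * ln (real n) / real n ^ d)"
    if "n > d" for n
  proof -
    let ?K = "real (max_kendall_code n (d + 1))"
    have n: "real n > 0" using that by simp
    have pow: "real n ^ d = real n ^ (d - 1) * real n"
      using assms by (metis Suc_diff_1 less_le_trans power_Suc2 zero_less_one)
    have "fact n \<le> A * n ^ (d - 1) * max_kendall_code n (d + 1)"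
      using fact_le_max_kendall_code[of n d] that unfolding A_def by simp
    then have "real (fact n) \<le> real (A * n ^ (d - 1) * max_kendall_code n (d + 1))"
      by (rule of_nat_mono)
    then have fact: "fact n \<le> real A * real n ^ (d - 1) * ?K" by simp
    have "ln (real n) \<le> real n" using ln_bound[OF n] .
    then have "fact n * ln (real n) \<le> fact n * real n" by (intro mult_left_mono) auto
    also have "\<dots> \<le> real A * real n ^ (d - 1) * ?K * real n"
      using fact n by (intro mult_right_mono) auto
    also have "\<dots> = ?K * (real A * real n ^ d)" by (simp add: pow)
    finally show ?thesis using A n by (simp add: field_simps)
  qed
  moreover have "1 / real A > 0" using A by simp
  ultimately show ?thesis by blast
qed

end
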